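(* Suppose $B\in\mathbb{R}^{m\times m}$ is invertible and $B=TW$ with $T=T^T\in\mathbb{R}^{m\times m}$ and $W=W^T\in\mathbb{R}^{m\times m}$. Let $(\widehat{p},\widehat{n},0)$ be the inertia of $W$. If $B$ has $m-s$ non-real eigenvalues, then $$\frac{1}{2}m-\frac{1}{2}s \leq \widehat{p} \leq \frac{1}{2}m+\frac{1}{2}s .$$
   Context: The inertia of a real symmetric matrix is the triple $(p,n,z)$, where $p$, $n$ and $z$ are respectively the numbers of positive, negative and zero eigenvalues, counted with multiplicity. Since $B=TW$ is invertible, $W$ is invertible and has no zero eigenvalues. "Non-real" refers to complex numbers with non-vanishing imaginary part. Eigenvalues of $B$ are counted with algebraic multiplicity, so $B$ has $m$ eigenvalues in total in $\mathbb{C}$, exactly $m-s$ of them non-real and exactly $s$ of them real. *)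

theory Defs
  imports "Jordan_Normal_Form.Char_Poly"
begin

text \<open>Eigenvalues lying in the base ring, with algebraic multiplicity.\<close>

definition eigenvalue_mset :: "'a::idom mat \<Rightarrow> 'a multiset" where
  "eigenvalue_mset A = proots (char_poly A)"

text \<open>
  Meant for symmetric matrices: these have only real eigenvalues, so the three
  numbers then add up to the dimension. For other real matrices the non-real
  eigenvalues are not counted.
\<close>

definition inertia :: "real mat \<Rightarrow> nat \<times> nat \<times> nat" where
  "inertia A =
     (size {# x \<in># eigenvalue_mset A. x > 0 #},
      size {# x \<in># eigenvalue_mset A. x < 0 #},
      size {# x \<in># eigenvalue_mset A. x = 0 #})"

definition num_nonreal_eigenvalues :: "real mat \<Rightarrow> nat" where
  "num_nonreal_eigenvalues A =
     size {# z \<in># eigenvalue_mset (map_mat complex_of_real A). Im z \<noteq> 0 #}"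

end

theory Submission
  imports Defs "Jordan_Normal_Form.Schur_Decomposition"
begin

text \<open>
  Since \<open>W B = W T W\<close> is symmetric, \<open>B\<close> is self-adjoint for the Hermitian form
  \<open>x\<^sup>* W y\<close> on complex vectors. Generalised eigenspaces of \<open>B\<close> for eigenvalues \<open>a\<close>, \<open>b\<close>
  with \<open>cnj a \<noteq> b\<close> are therefore orthogonal for this form, so those belonging to an open half
  plane (upper or lower) span an isotropic subspace. An isotropic subspace has dimension at most
  \<open>min p n\<close>, and one of the two half planes contains at least \<open>(m - s)/2\<close> eigenvalues.
\<close>

section \<open>Conjugate transposes and roots of split polynomials\<close>

abbreviation adj :: "complex mat \<Rightarrow> complex mat" where
  "adj A \<equiv> map_mat cnj (transpose_mat A)"

lemma adj_adj [simp]: "adj (adj A) = A"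
  by (rule eq_matI) auto

lemma adj_mult:
  assumes "A \<in> carrier_mat n k" and "B \<in> carrier_mat k l"
  shows "adj (A * B) = adj B * adj A"
  using assms by (intro eq_matI) (auto simp: scalar_prod_def cnj_sum intro!: sum.cong)

lemma adj_of_real_mat: "adj (map_mat complex_of_real A) = map_mat complex_of_real (transpose_mat A)"
  by (rule eq_matI) auto

lemma proots_prod_list_linear: "proots (\<Prod>a\<leftarrow>as. [:- a, 1:]) = mset as"
proof (induction as)
  case (Cons a as)
  have "(\<Prod>a\<leftarrow>as. [:- a, 1:]) \<noteq> 0"
    by (auto simp: prod_list_zero_iff)
  then show ?case
    using Cons by (simp add: proots_mult del: mult_pCons_left)
qed auto

section \<open>Unitary diagonalisation of Hermitian matrices\<close>

text \<open>Complete \<open>v\<close> to a basis, orthogonalise and normalise the columns: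
  Gram-Schmidt keeps its first vector, so only the normalisation changes \<open>v\<close>, whence
  the factor \<open>c\<close>. This supplies the deflation step of the diagonalisation
  below.\<close>

lemma unitary_with_first_column:
  fixes v :: "complex vec"
  assumes v: "v \<in> carrier_vec n" and v0: "v \<noteq> 0\<^sub>v n"
  obtains Q c where "Q \<in> carrier_mat n n" "adj Q * Q = 1\<^sub>m n" "col Q 0 = c \<cdot>\<^sub>v v"
proof -
  interpret cof_vec_space n "TYPE(complex)" .
  define b where "b = basis_completion v"
  define ws where "ws = gram_schmidt n b"
  from basis_completion[OF v v0, folded b_def]
  have dist_b: "distinct b" and indep: "\<not> lin_dep (set b)" and b: "set b \<subseteq> carrier_vec n"
    and hdb: "hd b = v" and len_b: "length b = n"
    by auto
  have n: "n \<noteq> 0"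
    using v v0 by (intro notI) auto
  from hdb len_b n obtain vs where bv: "b = v # vs"
    by (cases b) auto
  from gram_schmidt_result[OF b dist_b indep refl, folded ws_def]
  have ws: "set ws \<subseteq> carrier_vec n" and orth: "corthogonal ws" and len: "length ws = n"
    by (auto simp: len_b)
  from gram_schmidt_hd[OF v, of vs, folded bv] have "hd ws = v"
    unfolding ws_def .
  then have ws0: "ws ! 0 = v"
    using len n by (cases ws) auto
  have w: "ws ! i \<in> carrier_vec n" if "i < n" for i
    using ws len that by (metis nth_mem subsetD)
  \<comment> \<open>The Gram-Schmidt vectors are orthogonal but not normalised; \<open>r i\<close>
    is the Euclidean length of the \<open>i\<close>-th one.\<close>
  define r where "r i = sqrt (\<Sum>l<n. (cmod (ws ! i $ l))\<^sup>2)" for i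
  have prod: "(\<Sum>l<n. ws ! j $ l * cnj (ws ! i $ l)) = ws ! j \<bullet>c ws ! i" if "i < n" "j < n" for i j
    using w[OF that(1)] w[OF that(2)] by (simp add: scalar_prod_def atLeast0LessThan)
  have r: "complex_of_real (r i) * complex_of_real (r i) = ws ! i \<bullet>c ws ! i" if "i < n" for i
  proof -
    have "complex_of_real (r i) * complex_of_real (r i) = of_real (\<Sum>l<n. (cmod (ws ! i $ l))\<^sup>2)"
      unfolding r_def of_real_mult[symmetric] by (simp add: sum_nonneg)
    also have "\<dots> = (\<Sum>l<n. ws ! i $ l * cnj (ws ! i $ l))"
      by (simp only: of_real_sum complex_norm_square)
    finally show ?thesis
      using prod[OF that that] by simp
  qed
  define Q where "Q = mat n n (\<lambda>(i, j). ws ! j $ i / of_real (r j))"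
  have Q: "Q \<in> carrier_mat n n"
    by (simp add: Q_def)
  moreover have "adj Q * Q = 1\<^sub>m n"
  proof (rule eq_matI)
    fix i j assume "i < dim_row (1\<^sub>m n :: complex mat)" "j < dim_col (1\<^sub>m n :: complex mat)"
    then have ij: "i < n" "j < n"
      by auto
    have "(adj Q * Q) $$ (i, j) = (\<Sum>l<n. ws ! j $ l * cnj (ws ! i $ l)) / (of_real (r i) * of_real (r j))"
      using ij by (simp add: Q_def scalar_prod_def atLeast0LessThan sum_divide_distrib mult.commute)
    also have "\<dots> = (ws ! j \<bullet>c ws ! i) / (of_real (r i) * of_real (r j))"
      by (simp only: prod[OF ij])
    \<comment> \<open>\<open>corthogonalD\<close> says that the product vanishes exactly when the
      indices differ. For equal indices it therefore also shows that the denominator is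
      nonzero.\<close>
    also have "\<dots> = 1\<^sub>m n $$ (i, j)"
      using corthogonalD[OF orth, of j i] ij len r[OF ij(1)] by (cases "i = j") auto
    finally show "(adj Q * Q) $$ (i, j) = 1\<^sub>m n $$ (i, j)" .
  qed (auto simp: Q_def)
  moreover have "col Q 0 = (1 / of_real (r 0)) \<cdot>\<^sub>v v"
    using n v by (intro eq_vecI) (auto simp: Q_def ws0)
  ultimately show ?thesis
    using that by blast
qed

lemma complex_mat_has_eigenvector:
  fixes A :: "complex mat"
  assumes A: "A \<in> carrier_mat n n" and n: "n \<noteq> 0"
  obtains v e where "v \<in> carrier_vec n" "v \<noteq> 0\<^sub>v n" "A *\<^sub>v v = e \<cdot>\<^sub>v v"
proof -
  have "\<not> constant (poly (char_poly A))"
    using degree_monic_char_poly[OF A] n by (simp add: constant_degree)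
  then obtain e where "poly (char_poly A) e = 0"
    using fundamental_theorem_of_algebra by blast
  then have "eigenvalue A e"
    using eigenvalue_root_char_poly[OF A] by simp
  then show ?thesis
    using that A unfolding eigenvalue_def eigenvector_def by auto
qed

text \<open>Induction by deflation: in a unitary basis starting with an eigenvector, the matrix
  splits into a 1 by 1 block and a Hermitian block of size \<open>n\<close>, to which the induction
  hypothesis applies.\<close>

lemma hermitian_unitary_diagonalization:
  assumes "A \<in> carrier_mat n n" and "adj A = A"
  shows "\<exists>P D. P \<in> carrier_mat n n \<and> D \<in> carrier_mat n n \<and> adj P * P = 1\<^sub>m n \<and>
    adj P * A * P = D \<and> diagonal_mat D"
  using assms
proof (induction n arbitrary: A)
  case 0
  then show ?case
    by (intro exI[of _ "1\<^sub>m 0"] exI[of _ A]) (auto simp: diagonal_mat_def)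
next
  case (Suc n)
  note A = Suc.prems(1) and herm = Suc.prems(2)
  obtain v e where v: "v \<in> carrier_vec (Suc n)" "v \<noteq> 0\<^sub>v (Suc n)" and ev: "A *\<^sub>v v = e \<cdot>\<^sub>v v"
    using complex_mat_has_eigenvector[OF A] by auto
  obtain Q c where Q: "Q \<in> carrier_mat (Suc n) (Suc n)" and QQ: "adj Q * Q = 1\<^sub>m (Suc n)"
    and Q0: "col Q 0 = c \<cdot>\<^sub>v v"
    using unitary_with_first_column[OF v] .
  have aQ: "adj Q \<in> carrier_mat (Suc n) (Suc n)"
    using Q by auto
  define A' where "A' = adj Q * A * Q"
  have A': "A' \<in> carrier_mat (Suc n) (Suc n)"
    using A Q aQ by (auto simp: A'_def)
  have "adj A' = adj Q * adj (adj Q * A)"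
    unfolding A'_def using A Q aQ by (intro adj_mult) auto
  also have "adj (adj Q * A) = A * Q"
    using adj_mult[OF aQ A] herm by simp
  also have "adj Q * (A * Q) = A'"
    unfolding A'_def using assoc_mult_mat[OF aQ A Q] by simp
  finally have herm': "adj A' = A'" .
  have herm_ij: "cnj (A' $$ (j, i)) = A' $$ (i, j)" if "i < Suc n" "j < Suc n" for i j
    using arg_cong[OF herm', of "\<lambda>M. M $$ (i, j)"] A' that by auto
  have AQ: "A * Q \<in> carrier_mat (Suc n) (Suc n)"
    using A Q by auto
  \<comment> \<open>The first column of \<open>Q\<close> is a multiple of the eigenvector
    \<open>v\<close>, so the change of basis turns it into \<open>e\<close> times the first unit
    vector.\<close>
  have "col A' 0 = adj Q *\<^sub>v (A *\<^sub>v col Q 0)"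
    unfolding A'_def assoc_mult_mat[OF aQ A Q] col_mult2[OF aQ AQ zero_less_Suc]
      col_mult2[OF A Q zero_less_Suc] ..
  also have "A *\<^sub>v col Q 0 = e \<cdot>\<^sub>v col Q 0"
    unfolding Q0 mult_mat_vec[OF A v(1)] ev by (simp add: smult_smult_assoc mult.commute)
  also have "adj Q *\<^sub>v (e \<cdot>\<^sub>v col Q 0) = e \<cdot>\<^sub>v (adj Q *\<^sub>v col Q 0)"
    using Q by (intro mult_mat_vec[OF aQ]) (metis carrier_matD(1) col_dim)
  also have "adj Q *\<^sub>v col Q 0 = col (adj Q * Q) 0"
    by (rule col_mult2[OF aQ Q zero_less_Suc, symmetric])
  finally have col0: "col A' 0 = e \<cdot>\<^sub>v unit_vec (Suc n) 0"
    unfolding QQ by simp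
  have A'0: "A' $$ (i, 0) = (if i = 0 then e else 0)" if "i < Suc n" for i
    using arg_cong[OF col0, of "\<lambda>v. v $ i"] A' that by auto
  define A4 where "A4 = mat n n (\<lambda>(i, j). A' $$ (Suc i, Suc j))"
  let ?z = "0\<^sub>m 1 n" and ?z' = "0\<^sub>m n 1"
  have A4: "A4 \<in> carrier_mat n n"
    by (simp add: A4_def)
  have "adj A4 = A4"
    using herm_ij by (intro eq_matI) (auto simp: A4_def)
  from Suc.IH[OF A4 this] obtain P D where P: "P \<in> carrier_mat n n" and D: "D \<in> carrier_mat n n"
    and PP: "adj P * P = 1\<^sub>m n" and PAP: "adj P * A4 * P = D" and diag: "diagonal_mat D"
    by blast
  have aP: "adj P \<in> carrier_mat n n"
    using P by auto
  define E where "E = mat 1 1 (\<lambda>_. e)"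
  have E: "E \<in> carrier_mat 1 1"
    by (simp add: E_def)
  \<comment> \<open>The computed column gives the zeros below \<open>e\<close>; Hermitian symmetry
    gives those to its right.\<close>
  have A'_block: "A' = four_block_mat E ?z ?z' A4"
  proof (rule eq_matI)
    fix i j
    assume "i < dim_row (four_block_mat E ?z ?z' A4)" "j < dim_col (four_block_mat E ?z ?z' A4)"
    then have "i < Suc n" "j < Suc n"
      using E A4 by auto
    then show "A' $$ (i, j) = four_block_mat E ?z ?z' A4 $$ (i, j)"
      using A'0[of i] A'0[of j] herm_ij[of i j] by (auto simp: E_def A4_def)
  qed (use A' E A4 in auto)
  define P' where "P' = four_block_mat (1\<^sub>m 1) ?z ?z' P"
  have P': "P' \<in> carrier_mat (Suc n) (Suc n)"
    using P unfolding P'_def by auto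
  have adjP': "adj P' = four_block_mat (1\<^sub>m 1) ?z ?z' (adj P)"
    unfolding P'_def using P by (intro eq_matI) auto
  have aP': "adj P' \<in> carrier_mat (Suc n) (Suc n)"
    using P' by auto
  have P'P': "adj P' * P' = 1\<^sub>m (Suc n)"
    unfolding adjP' unfolding P'_def
    by (subst mult_four_block_mat[where ?nr1.0 = 1 and ?n1.0 = 1 and ?n2.0 = n and ?nr2.0 = n
          and ?nc1.0 = 1 and ?nc2.0 = n]) (use P aP PP in auto)
  have "adj P' * A' = four_block_mat E ?z ?z' (adj P * A4)"
    unfolding adjP' A'_block
    by (subst mult_four_block_mat[where ?nr1.0 = 1 and ?n1.0 = 1 and ?n2.0 = n and ?nr2.0 = n
          and ?nc1.0 = 1 and ?nc2.0 = n]) (use aP E A4 in auto)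
  then have PAP': "adj P' * A' * P' = four_block_mat E ?z ?z' D"
    unfolding P'_def PAP[symmetric]
    by (simp, subst mult_four_block_mat[where ?nr1.0 = 1 and ?n1.0 = 1 and ?n2.0 = n
          and ?nr2.0 = n and ?nc1.0 = 1 and ?nc2.0 = n]) (use aP P E A4 in auto)
  have diag': "diagonal_mat (four_block_mat E ?z ?z' D)"
    using diag D E unfolding diagonal_mat_def by auto
  have adjQP: "adj (Q * P') = adj P' * adj Q"
    using adj_mult[OF Q P'] .
  have "adj (Q * P') * (Q * P') = adj P' * (adj Q * Q) * P'"
    unfolding adjQP using Q P' aQ aP'
    by (simp add: assoc_mult_mat[where ?n\<^sub>3 = "Suc n" and ?n\<^sub>4 = "Suc n"])
  also have "\<dots> = 1\<^sub>m (Suc n)"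
    unfolding QQ using P'P' aP' by simp
  finally have 1: "adj (Q * P') * (Q * P') = 1\<^sub>m (Suc n)" .
  have "adj (Q * P') * A * (Q * P') = adj P' * A' * P'"
    unfolding adjQP A'_def using Q P' aQ aP' A
    by (simp add: assoc_mult_mat[where ?n\<^sub>3 = "Suc n" and ?n\<^sub>4 = "Suc n"])
  then have 2: "adj (Q * P') * A * (Q * P') = four_block_mat E ?z ?z' D"
    unfolding PAP' .
  show ?case
    using 1 2 diag' Q P' E D
    by (intro exI[of _ "Q * P'"] exI[of _ "four_block_mat E ?z ?z' D"]) auto
qed

text \<open>The diagonal form is again Hermitian, so its entries are real. Similarity then splits
  the complex characteristic polynomial into real linear factors, and injectivity of the embedding
  of real polynomials carries the factorisation back to \<open>W\<close>. This links the inertia of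
  \<open>W\<close> to the signs of the \<open>d i\<close>.\<close>

lemma real_symmetric_unitary_diagonalization:
  fixes W :: "real mat"
  assumes W: "W \<in> carrier_mat m m" and sym: "W = transpose_mat W"
  obtains P :: "complex mat" and d :: "nat \<Rightarrow> real"
  where "P \<in> carrier_mat m m" "adj P * P = 1\<^sub>m m"
    "adj P * map_mat complex_of_real W * P = mat m m (\<lambda>(i, j). if i = j then of_real (d i) else 0)"
    "eigenvalue_mset W = mset (map d [0..<m])"
proof -
  interpret hp: map_poly_inj_comm_ring_hom complex_of_real ..
  let ?W = "map_mat complex_of_real W"
  have cW: "?W \<in> carrier_mat m m"
    using W by auto
  have hermW: "adj ?W = ?W"
    using sym adj_of_real_mat[of W] by simp
  obtain P D where P: "P \<in> carrier_mat m m" and D: "D \<in> carrier_mat m m"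
    and PP: "adj P * P = 1\<^sub>m m" and PWP: "adj P * ?W * P = D" and diag: "diagonal_mat D"
    using hermitian_unitary_diagonalization[OF cW hermW] by blast
  have aP: "adj P \<in> carrier_mat m m"
    using P by auto
  have "adj D = adj P * adj (adj P * ?W)"
    unfolding PWP[symmetric] using cW P aP by (intro adj_mult) auto
  also have "adj (adj P * ?W) = ?W * P"
    using adj_mult[OF aP cW] hermW by simp
  also have "adj P * (?W * P) = D"
    using assoc_mult_mat[OF aP cW P] PWP by simp
  finally have hermD: "adj D = D" .
  define d where "d i = Re (D $$ (i, i))" for i
  have Dii: "D $$ (i, i) = of_real (d i)" if "i < m" for i
  proof -
    have "cnj (D $$ (i, i)) = D $$ (i, i)"
      using arg_cong[OF hermD, of "\<lambda>M. M $$ (i, i)"] that D by auto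
    then show ?thesis
      by (auto simp: d_def complex_eq_iff)
  qed
  have D_eq: "D = mat m m (\<lambda>(i, j). if i = j then of_real (d i) else 0)"
    using D Dii diag by (intro eq_matI) (auto simp: diagonal_mat_def)
  have "similar_mat_wit D ?W (adj P) P"
    using PP mat_mult_left_right_inverse[OF aP P PP] PWP D cW aP P
    by (intro similar_mat_witI[of _ _ m]) auto
  then have "char_poly ?W = char_poly D"
    using char_poly_similar unfolding similar_mat_def by metis
  also have "\<dots> = (\<Prod>a\<leftarrow>diag_mat D. [:- a, 1:])"
    using D diag by (intro char_poly_upper_triangular) (auto simp: diagonal_mat_def)
  also have "diag_mat D = map (\<lambda>i. of_real (d i)) [0..<m]"
    using D Dii by (auto simp: diag_mat_def)
  also have "(\<Prod>a\<leftarrow>map (\<lambda>i. complex_of_real (d i)) [0..<m]. [:- a, 1:]) =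
      map_poly of_real (\<Prod>a\<leftarrow>map d [0..<m]. [:- a, 1:])"
    by (simp add: hp.hom_prod_list o_def)
  finally have "char_poly W = (\<Prod>a\<leftarrow>map d [0..<m]. [:- a, 1:])"
    unfolding of_real_hom.char_poly_hom[OF W] by simp
  then have "eigenvalue_mset W = mset (map d [0..<m])"
    unfolding eigenvalue_mset_def by (simp only: proots_prod_list_linear)
  then show ?thesis
    using that P PP PWP D_eq by blast
qed

section \<open>Isotropic subspaces of a diagonal form\<close>

lemma size_filter_mset_map_upt:
  "size (filter_mset R (mset (map d [0..<m]))) = card {i. i < m \<and> R (d i)}"
proof -
  have "size (filter_mset R (mset (map d [0..<m]))) = length (filter R (map d [0..<m]))"
    by (simp only: mset_filter[symmetric] size_mset)
  also have "\<dots> = card {i. i < m \<and> R (d i)}"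
    unfolding length_filter_conv_card by (intro arg_cong[where f = card]) auto
  finally show ?thesis .
qed

text \<open>Padded with zero rows to a square matrix, the conditions leave at least the last row
  zero; the matrix is singular and so has a nonzero kernel vector.\<close>

lemma exists_common_kernel_vector:
  fixes rs :: "'a :: field vec list"
  assumes "length rs < m"
  obtains v where "v \<in> carrier_vec m" "v \<noteq> 0\<^sub>v m" "\<And>r. r \<in> set rs \<Longrightarrow> r \<in> carrier_vec m \<Longrightarrow> r \<bullet> v = 0"
proof -
  define M where "M = mat m m (\<lambda>(i, j). if i < length rs then rs ! i $ j else 0)"
  have M: "M \<in> carrier_mat m m" and tM: "transpose_mat M \<in> carrier_mat m m"
    by (auto simp: M_def)
  have "transpose_mat M *\<^sub>v unit_vec m (m - 1) = 0\<^sub>v m"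
    using assms by (intro eq_vecI) (auto simp: M_def scalar_prod_def unit_vec_def intro!: sum.neutral)
  moreover have "unit_vec m (m - 1) \<noteq> (0\<^sub>v m :: 'a vec)"
    using assms by (intro notI, drule_tac arg_cong[where f = "\<lambda>v. v $ (m - 1)"]) auto
  ultimately have "det M = 0"
    using det_0_iff_vec_prod_zero[OF tM] det_transpose[OF M] unit_vec_carrier by metis
  then obtain v where v: "v \<in> carrier_vec m" "v \<noteq> 0\<^sub>v m" and Mv: "M *\<^sub>v v = 0\<^sub>v m"
    using det_0_iff_vec_prod_zero[OF M] by auto
  have "r \<bullet> v = 0" if r: "r \<in> set rs" "r \<in> carrier_vec m" for r
  proof -
    from r obtain i where i: "i < length rs" "rs ! i = r"
      by (auto simp: in_set_conv_nth)
    have "row M i = r"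
      using i r assms by (intro eq_vecI) (auto simp: M_def)
    then show ?thesis
      using arg_cong[OF Mv, of "\<lambda>v. v $ i"] i assms M by auto
  qed
  then show ?thesis
    using that v by blast
qed

text \<open>The first \<open>k\<close> columns of \<open>Y\<close> span an isotropic subspace of the
  form with diagonal \<open>d\<close>. Were \<open>k\<close> larger than the number of nonnegative
  \<open>d l\<close>, some nonzero vector of this subspace would vanish in all those coordinates.
  The form is negative definite on such vectors, a contradiction.\<close>

lemma isotropic_dim_le_card_nonneg:
  fixes Y :: "complex mat" and d :: "nat \<Rightarrow> real"
  assumes Y: "Y \<in> carrier_mat m m" and km: "k \<le> m"
    and inj: "\<And>v. v \<in> carrier_vec m \<Longrightarrow> Y *\<^sub>v v = 0\<^sub>v m \<Longrightarrow> v = 0\<^sub>v m"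
    and iso: "\<And>i j. i < k \<Longrightarrow> j < k \<Longrightarrow>
      (\<Sum>l<m. of_real (d l) * (cnj (Y $$ (l, i)) * Y $$ (l, j))) = 0"
  shows "k \<le> card {l. l < m \<and> d l \<ge> 0}"
proof (rule ccontr)
  assume less: "\<not> ?thesis"
  define I where "I = filter (\<lambda>l. d l \<ge> 0) [0..<m]"
  have I: "set I = {l. l < m \<and> d l \<ge> 0}" "length I = card {l. l < m \<and> d l \<ge> 0}"
    using distinct_card[of I] by (auto simp: I_def)
  \<comment> \<open>the last \<open>m - k\<close> conditions confine the vector to the first \<open>k\<close> coordinates\<close>
  define rs where "rs = map (row Y) I @ map (unit_vec m) [k..<m]"
  have "length rs < m"
    using less I km by (simp add: rs_def)
  then obtain v where v: "v \<in> carrier_vec m" "v \<noteq> 0\<^sub>v m"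
    and rv: "\<And>r. r \<in> set rs \<Longrightarrow> r \<in> carrier_vec m \<Longrightarrow> r \<bullet> v = 0"
    using exists_common_kernel_vector by blast
  define y where "y l = (Y *\<^sub>v v) $ l" for l
  have v0: "v $ j = 0" if "k \<le> j" "j < m" for j
    using rv[of "unit_vec m j"] that v by (auto simp: rs_def)
  have y0: "y l = 0" if "l < m" "d l \<ge> 0" for l
    using rv[of "row Y l"] that Y I by (auto simp: rs_def y_def)
  have y: "y l = (\<Sum>j<k. Y $$ (l, j) * v $ j)" if "l < m" for l
  proof -
    have "y l = (\<Sum>j<m. Y $$ (l, j) * v $ j)"
      using that Y v by (auto simp: y_def scalar_prod_def atLeast0LessThan)
    also have "\<dots> = (\<Sum>j<k. Y $$ (l, j) * v $ j)"
      using km v0 by (intro sum.mono_neutral_right) auto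
    finally show ?thesis .
  qed
  \<comment> \<open>The value of the form at \<open>y\<close> expands sesquilinearly into pairings
    of the first \<open>k\<close> columns of \<open>Y\<close>, all of which are zero by
    \<open>iso\<close>.\<close>
  have "complex_of_real (\<Sum>l<m. d l * (cmod (y l))\<^sup>2) = (\<Sum>l<m. of_real (d l) * (cnj (y l) * y l))"
    unfolding of_real_sum of_real_mult complex_norm_square by (simp add: mult.commute)
  also have "\<dots> = (\<Sum>l<m. \<Sum>i<k. \<Sum>j<k. cnj (v $ i) * v $ j *
      (of_real (d l) * (cnj (Y $$ (l, i)) * Y $$ (l, j))))"
    by (intro sum.cong refl) (simp add: y cnj_sum sum_product sum_distrib_left mult_ac)
  also have "\<dots> = (\<Sum>i<k. \<Sum>l<m. \<Sum>j<k. cnj (v $ i) * v $ j *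
      (of_real (d l) * (cnj (Y $$ (l, i)) * Y $$ (l, j))))"
    by (rule sum.swap)
  also have "\<dots> = (\<Sum>i<k. \<Sum>j<k. \<Sum>l<m. cnj (v $ i) * v $ j *
      (of_real (d l) * (cnj (Y $$ (l, i)) * Y $$ (l, j))))"
    by (intro sum.cong refl sum.swap)
  also have "\<dots> = 0"
    by (simp add: sum_distrib_left[symmetric] iso)
  finally have sum0: "(\<Sum>l<m. d l * (cmod (y l))\<^sup>2) = 0"
    by (simp only: of_real_eq_0_iff)
  \<comment> \<open>Coordinates with \<open>d l \<ge> 0\<close> were forced to vanish, so no term is
    positive. As the terms sum to zero, each is zero, and so is \<open>y l\<close> where
    \<open>d l < 0\<close>.\<close>
  have nonpos: "d l * (cmod (y l))\<^sup>2 \<le> 0" if "l \<in> {..<m}" for l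
    using y0[of l] that by (cases "d l \<ge> 0") (auto simp: mult_nonpos_nonneg)
  have "d l * (cmod (y l))\<^sup>2 = 0" if "l < m" for l
    using sum_nonneg_0[of "{..<m}" "\<lambda>l. - (d l * (cmod (y l))\<^sup>2)" l] nonpos sum0 that
    by (auto simp: sum_negf)
  then have "y l = 0" if "l < m" for l
    using y0[of l] that by fastforce
  then have "Y *\<^sub>v v = 0\<^sub>v m"
    using Y by (intro eq_vecI) (auto simp: y_def)
  then show False
    using inj v by blast
qed

section \<open>Isotropy of the selected generalised eigenspaces\<close>

text \<open>By triangularity, entry \<open>(i, j)\<close> of the equation involves only
  \<open>G $$ (i, j)\<close> and entries of \<open>G\<close> with smaller index sum. By induction
  the latter vanish, which leaves
  \<open>cnj (U $$ (i, i)) * G $$ (i, j) = G $$ (i, j) * U $$ (j, j)\<close>, and the two factors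
  from \<open>U\<close> differ.\<close>

lemma sylvester_leading_block_zero:
  fixes U G :: "complex mat"
  assumes U: "U \<in> carrier_mat m m" and G: "G \<in> carrier_mat m m" and ut: "upper_triangular U"
    and eq: "adj U * G = G * U" and km: "k \<le> m"
    and ne: "\<And>i j. i < k \<Longrightarrow> j < k \<Longrightarrow> cnj (U $$ (i, i)) \<noteq> U $$ (j, j)"
    and "i < k" and "j < k"
  shows "G $$ (i, j) = 0"
  using \<open>i < k\<close> \<open>j < k\<close>
proof (induction "i + j" arbitrary: i j rule: less_induct)
  case less
  then have ij: "i < m" "j < m"
    using km by auto
  have "(\<Sum>l<m. cnj (U $$ (l, i)) * G $$ (l, j)) = (\<Sum>l<m. G $$ (i, l) * U $$ (l, j))"
    using arg_cong[OF eq, of "\<lambda>M. M $$ (i, j)"] ij U G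
    by (simp add: scalar_prod_def atLeast0LessThan)
  \<comment> \<open>Terms with \<open>l > i\<close> vanish because \<open>U\<close> is upper
    triangular, those with \<open>l < i\<close> by the induction hypothesis. The other sum is
    treated in the same way around \<open>j\<close>.\<close>
  also have "(\<Sum>l<m. cnj (U $$ (l, i)) * G $$ (l, j)) = (\<Sum>l\<in>{i}. cnj (U $$ (l, i)) * G $$ (l, j))"
  proof (intro sum.mono_neutral_right ballI)
    fix l assume "l \<in> {..<m} - {i}"
    then show "cnj (U $$ (l, i)) * G $$ (l, j) = 0"
      using less.hyps[of l j] less.prems U ut upper_triangularD[of U i l]
      by (cases l i rule: linorder_cases) auto
  qed (use ij in auto)
  also have "(\<Sum>l<m. G $$ (i, l) * U $$ (l, j)) = (\<Sum>l\<in>{j}. G $$ (i, l) * U $$ (l, j))"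
  proof (intro sum.mono_neutral_right ballI)
    fix l assume "l \<in> {..<m} - {j}"
    then show "G $$ (i, l) * U $$ (l, j) = 0"
      using less.hyps[of i l] less.prems U ut upper_triangularD[of U j l]
      by (cases l j rule: linorder_cases) auto
  qed (use ij in auto)
  finally show ?case
    using ne[OF less.prems] by auto
qed

text \<open>Applied with \<open>S\<close> an open half plane; taking \<open>a = b\<close> shows that
  \<open>S\<close> contains no real number. \<open>W\<close> may be singular here, and its kernel is
  isotropic, which is why \<open>z\<close> enters both bounds.\<close>

lemma num_eigenvalues_le_inertia:
  fixes B W :: "real mat"
  assumes B: "B \<in> carrier_mat m m" and W: "W \<in> carrier_mat m m" and sym: "W = transpose_mat W"
    and self_adjoint: "transpose_mat B * W = W * B"
    and inertia: "inertia W = (p, n, z)"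
    and S: "\<And>a b. S a \<Longrightarrow> S b \<Longrightarrow> cnj a \<noteq> b"
  shows "size (filter_mset S (eigenvalue_mset (map_mat complex_of_real B))) \<le> p + z"
    and "size (filter_mset S (eigenvalue_mset (map_mat complex_of_real B))) \<le> n + z"
proof -
  let ?W = "map_mat complex_of_real W" and ?B = "map_mat complex_of_real B"
  have cW: "?W \<in> carrier_mat m m" and cB: "?B \<in> carrier_mat m m"
    and aB: "adj ?B \<in> carrier_mat m m"
    using W B by auto
  have BW: "adj ?B * ?W = ?W * ?B"
    unfolding adj_of_real_mat using self_adjoint W B
    by (metis of_real_hom.mat_hom_mult transpose_carrier_mat)
  obtain Q d where Q: "Q \<in> carrier_mat m m" and QQ: "adj Q * Q = 1\<^sub>m m"
    and QWQ: "adj Q * ?W * Q = mat m m (\<lambda>(i, j). if i = j then of_real (d i) else 0)"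
    and ev: "eigenvalue_mset W = mset (map d [0..<m])"
    using real_symmetric_unitary_diagonalization[OF W sym] by blast
  define D :: "complex mat" where "D = mat m m (\<lambda>(i, j). if i = j then of_real (d i) else 0)"
  have D: "D \<in> carrier_mat m m"
    by (simp add: D_def)
  have aQ: "adj Q \<in> carrier_mat m m"
    using Q by auto
  have QQ': "Q * adj Q = 1\<^sub>m m"
    using mat_mult_left_right_inverse[OF aQ Q QQ] .
  obtain as where as: "char_poly ?B = (\<Prod>a\<leftarrow>as. [:- a, 1:])" and len: "length as = m"
    using char_poly_factorized[OF cB] by auto
  \<comment> \<open>the Schur form keeps this order, so its first \<open>k\<close> basis vectors span the
    generalised eigenspaces selected by \<open>S\<close>\<close>
  define es where "es = filter S as @ filter (\<lambda>a. \<not> S a) as"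
  have mset_es: "mset es = mset as"
    by (simp add: es_def)
  have len_es: "length es = m"
    using mset_es len by (metis size_mset)
  have es: "char_poly ?B = (\<Prod>a\<leftarrow>es. [:- a, 1:])"
    unfolding as using mset_es by (metis mset_map prod_mset_prod_list)
  define k where "k = length (filter S as)"
  have "eigenvalue_mset ?B = mset as"
    unfolding eigenvalue_mset_def as by (rule proots_prod_list_linear)
  then have k: "size (filter_mset S (eigenvalue_mset ?B)) = k"
    by (simp add: k_def flip: mset_filter)
  have km: "k \<le> m"
    using len by (auto simp: k_def)
  obtain U P P' where schur: "schur_decomposition ?B es = (U, P, P')"
    by (cases "schur_decomposition ?B es") auto
  from schur_decomposition[OF cB es schur] have wit: "similar_mat_wit ?B U P P'"
    and ut: "upper_triangular U" and diag: "diag_mat U = es"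
    by auto
  note simD = similar_mat_witD2[OF cB wit]
  have U: "U \<in> carrier_mat m m" and P: "P \<in> carrier_mat m m" and P': "P' \<in> carrier_mat m m"
    and P'P: "P' * P = 1\<^sub>m m" and B_eq: "?B = P * U * P'"
    using simD by auto
  have aP: "adj P \<in> carrier_mat m m" and aU: "adj U \<in> carrier_mat m m"
    using P U by auto
  have Uii: "S (U $$ (i, i))" if "i < k" for i
  proof -
    have "U $$ (i, i) = es ! i"
      using diag U that km by (auto simp: diag_mat_def)
    also have "\<dots> \<in> set (filter S as)"
      using that unfolding es_def k_def nth_append by (simp only: if_True nth_mem)
    finally show ?thesis
      by simp
  qed
  have BP: "?B * P = P * U"
    unfolding B_eq using P U P' P'P
    by (simp add: assoc_mult_mat[where ?n\<^sub>2 = m and ?n\<^sub>3 = m and ?n\<^sub>4 = m])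
  \<comment> \<open>\<open>G\<close> is the Gram matrix of the form given by \<open>W\<close> in the
    Schur basis, the columns of \<open>P\<close>. Self-adjointness of \<open>B\<close> becomes
    \<open>adj U * G = G * U\<close> in this basis.\<close>
  define G where "G = adj P * ?W * P"
  have G: "G \<in> carrier_mat m m"
    using P cW by (auto simp: G_def)
  have "adj U * G = adj (P * U) * ?W * P"
    unfolding G_def adj_mult[OF P U] using aU aP cW P
    by (simp add: assoc_mult_mat[where ?n\<^sub>2 = m and ?n\<^sub>3 = m and ?n\<^sub>4 = m])
  also have "\<dots> = adj P * (adj ?B * ?W) * P"
    unfolding BP[symmetric] adj_mult[OF cB P] using aB aP cW P
    by (simp add: assoc_mult_mat[where ?n\<^sub>2 = m and ?n\<^sub>3 = m and ?n\<^sub>4 = m])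
  also have "\<dots> = adj P * ?W * (?B * P)"
    unfolding BW using cB aP cW P
    by (simp add: assoc_mult_mat[where ?n\<^sub>2 = m and ?n\<^sub>3 = m and ?n\<^sub>4 = m])
  also have "\<dots> = G * U"
    unfolding BP G_def using U aP cW P
    by (simp add: assoc_mult_mat[where ?n\<^sub>2 = m and ?n\<^sub>3 = m and ?n\<^sub>4 = m])
  finally have sylv: "adj U * G = G * U" .
  have G0: "G $$ (i, j) = 0" if "i < k" "j < k" for i j
    using sylvester_leading_block_zero[OF U G ut sylv km _ that] S Uii by blast
  \<comment> \<open>The columns of \<open>Y\<close> are the Schur basis vectors in coordinates of
    the orthonormal eigenbasis \<open>Q\<close> of \<open>W\<close>, where the form is diagonal. The
    vanishing leading block of \<open>G\<close> then reads as isotropy for \<open>d\<close>.\<close>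
  define Y where "Y = adj Q * P"
  have Y: "Y \<in> carrier_mat m m" and aY: "adj Y \<in> carrier_mat m m"
    using aQ P by (auto simp: Y_def)
  have QY: "Q * Y = P"
    unfolding Y_def using Q aQ P QQ'
    by (simp flip: assoc_mult_mat[where ?n\<^sub>2 = m and ?n\<^sub>3 = m and ?n\<^sub>4 = m])
  have "G = adj (Q * Y) * ?W * (Q * Y)"
    unfolding QY G_def ..
  also have "\<dots> = adj Y * (adj Q * ?W * Q) * Y"
    unfolding adj_mult[OF Q Y] using aY aQ cW Q Y
    by (simp add: assoc_mult_mat[where ?n\<^sub>2 = m and ?n\<^sub>3 = m and ?n\<^sub>4 = m])
  finally have GY: "G = adj Y * D * Y"
    unfolding QWQ D_def .
  have iso: "(\<Sum>l<m. of_real (d l) * (cnj (Y $$ (l, i)) * Y $$ (l, j))) = 0" if "i < k" "j < k" for i j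
  proof -
    have ij: "i < m" "j < m"
      using that km by auto
    have YD: "(adj Y * D) $$ (i, l) = cnj (Y $$ (l, i)) * of_real (d l)" if "l < m" for l
    proof -
      have "(adj Y * D) $$ (i, l) = (\<Sum>r<m. cnj (Y $$ (r, i)) * D $$ (r, l))"
        using ij that Y D by (simp add: scalar_prod_def atLeast0LessThan)
      also have "\<dots> = (\<Sum>r<m. if r = l then cnj (Y $$ (l, i)) * of_real (d l) else 0)"
        using that by (intro sum.cong) (auto simp: D_def)
      finally show ?thesis
        using that by simp
    qed
    have "G $$ (i, j) = (\<Sum>l<m. (adj Y * D) $$ (i, l) * Y $$ (l, j))"
      unfolding GY using ij Y D aY
      by (subst index_mult_mat(1))
        (auto simp: scalar_prod_def atLeast0LessThan row_def simp del: index_mult_mat(1))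
    also have "\<dots> = (\<Sum>l<m. of_real (d l) * (cnj (Y $$ (l, i)) * Y $$ (l, j)))"
      by (intro sum.cong) (simp_all add: YD mult_ac del: index_mult_mat(1))
    finally show ?thesis
      using G0[OF that] by simp
  qed
  have inj: "v = 0\<^sub>v m" if v: "v \<in> carrier_vec m" "Y *\<^sub>v v = 0\<^sub>v m" for v
  proof -
    have "P *\<^sub>v v = Q *\<^sub>v (Y *\<^sub>v v)"
      unfolding QY[symmetric] by (rule assoc_mult_mat_vec[OF Q Y v(1)])
    then have "P' *\<^sub>v (P *\<^sub>v v) = 0\<^sub>v m"
      unfolding v(2) using Q P' by (auto simp: scalar_prod_def)
    then show ?thesis
      unfolding assoc_mult_mat_vec[OF P' P v(1), symmetric] P'P using v by simp
  qed
  have p: "p = card {l. l < m \<and> d l > 0}" and n: "n = card {l. l < m \<and> d l < 0}"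
    and z: "z = card {l. l < m \<and> d l = 0}"
    using inertia unfolding inertia_def ev size_filter_mset_map_upt by auto
  have "k \<le> card {l. l < m \<and> d l \<ge> 0}"
    using isotropic_dim_le_card_nonneg[OF Y km inj iso] .
  also have "{l. l < m \<and> d l \<ge> 0} = {l. l < m \<and> d l > 0} \<union> {l. l < m \<and> d l = 0}"
    by auto
  also have "card \<dots> \<le> p + z"
    unfolding p z by (rule card_Un_le)
  finally show "size (filter_mset S (eigenvalue_mset ?B)) \<le> p + z"
    unfolding k .
  \<comment> \<open>The same subspace is isotropic for the negated form, for which negative and
    positive eigenvalues trade places.\<close>
  have iso': "(\<Sum>l<m. of_real (- d l) * (cnj (Y $$ (l, i)) * Y $$ (l, j))) = 0" if "i < k" "j < k" for i j
    using iso[OF that] by (simp add: sum_negf)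
  have "k \<le> card {l. l < m \<and> - d l \<ge> 0}"
    using isotropic_dim_le_card_nonneg[OF Y km inj iso'] .
  also have "{l. l < m \<and> - d l \<ge> 0} = {l. l < m \<and> d l < 0} \<union> {l. l < m \<and> d l = 0}"
    by auto
  also have "card \<dots> \<le> n + z"
    unfolding n z by (rule card_Un_le)
  finally show "size (filter_mset S (eigenvalue_mset ?B)) \<le> n + z"
    unfolding k .
qed

section \<open>Counting eigenvalues in the two half planes\<close>

text \<open>The characteristic polynomial of a symmetric matrix splits over the reals, so no
  eigenvalue is lost when only real roots are counted.\<close>

lemma inertia_sum:
  assumes W: "W \<in> carrier_mat m m" and sym: "W = transpose_mat W" and "inertia W = (p, n, z)"
  shows "p + n + z = m"
proof -
  obtain d where ev: "eigenvalue_mset W = mset (map d [0..<m])"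
    using real_symmetric_unitary_diagonalization[OF W sym] by blast
  have "size (filter_mset (\<lambda>x. x > 0) M) + size (filter_mset (\<lambda>x. x < 0) M) +
      size (filter_mset (\<lambda>x. x = 0) M) = size M" for M :: "real multiset"
    by (induction M) auto
  from this[of "eigenvalue_mset W"] show ?thesis
    using assms(3) unfolding inertia_def by (simp add: ev)
qed

theorem corollary1p5:
  fixes B T W :: "real mat" and m s p n :: nat
  assumes "B \<in> carrier_mat m m" and "T \<in> carrier_mat m m" and "W \<in> carrier_mat m m"
    and "invertible_mat B"
    and "B = T * W"
    and "T = transpose_mat T"
    and "W = transpose_mat W"
    and "inertia W = (p, n, 0)"
    and "s \<le> m"
    and "num_nonreal_eigenvalues B = m - s"
  shows "(1/2) * real m - (1/2) * real s \<le> real p \<and> real p \<le> (1/2) * real m + (1/2) * real s"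
proof -
  \<comment> \<open>Both \<open>transpose_mat B * W\<close> and \<open>W * B\<close> equal
    \<open>W * T * W\<close>; this is the only way in which the factorisation of \<open>B\<close>
    enters.\<close>
  have "transpose_mat B = W * T"
    using assms(5) transpose_mult[OF assms(2,3)] assms(6,7) by simp
  then have self_adjoint: "transpose_mat B * W = W * B"
    using assms(5) assoc_mult_mat[OF assms(3,2,3)] by simp
  let ?E = "eigenvalue_mset (map_mat complex_of_real B)"
  \<comment> \<open>Conjugation exchanges the two half planes, so neither contains a conjugate
    pair.\<close>
  have "cnj a \<noteq> b" if "Im a > 0" "Im b > 0" for a b
    using that by auto
  then have upper: "size (filter_mset (\<lambda>z. Im z > 0) ?E) \<le> p" "size (filter_mset (\<lambda>z. Im z > 0) ?E) \<le> n"
    using num_eigenvalues_le_inertia[OF assms(1,3,7) self_adjoint assms(8), of "\<lambda>z. Im z > 0"]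
    by simp_all
  have "cnj a \<noteq> b" if "Im a < 0" "Im b < 0" for a b
    using that by auto
  then have lower: "size (filter_mset (\<lambda>z. Im z < 0) ?E) \<le> p" "size (filter_mset (\<lambda>z. Im z < 0) ?E) \<le> n"
    using num_eigenvalues_le_inertia[OF assms(1,3,7) self_adjoint assms(8), of "\<lambda>z. Im z < 0"]
    by simp_all
  have "size (filter_mset (\<lambda>z. Im z \<noteq> 0) M) =
      size (filter_mset (\<lambda>z. Im z > 0) M) + size (filter_mset (\<lambda>z. Im z < 0) M)" for M
    by (induction M) auto
  then have "m - s = size (filter_mset (\<lambda>z. Im z > 0) ?E) + size (filter_mset (\<lambda>z. Im z < 0) ?E)"
    using assms(10) unfolding num_nonreal_eigenvalues_def by simp
  moreover have "p + n = m"
    using inertia_sum[OF assms(3,7,8)] by simp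
  \<comment> \<open>Adding the bounds of both half planes gives \<open>m - s \<le> 2 * p\<close> and
    \<open>m - s \<le> 2 * n\<close>. With \<open>n = m - p\<close> the second is the upper bound on
    \<open>p\<close>; \<open>s \<le> m\<close> makes the natural-number subtraction exact.\<close>
  ultimately show ?thesis
    using upper lower assms(9) by linarith
qed

end
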